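(* Let $\sigma:\Sigma\to\Sigma$ be a one-sided subshift of finite type. For every potential $A\in C^0(\hat\Sigma)$, $$\beta_A=\inf_{f\in C^0(\Sigma)}\ \max_{(\mathbf y,\mathbf x)\in\hat\Sigma}\bigl[A(\mathbf y,\mathbf x)+f(\mathbf x)-f(\tau_{\mathbf y}(\mathbf x))\bigr].$$
   Context: Let $\mathbf M$ be an $r\times r$ matrix with entries in $\{0,1\}$. The one-sided subshift of finite type is $\Sigma=\{\mathbf x=(x_0,x_1,\ldots)\in\{1,\ldots,r\}^{\mathbb N}:\mathbf M(x_j,x_{j+1})=1\ \forall j\ge 0\}$ (nonempty), with the left shift $\sigma(x_0,x_1,\ldots)=(x_1,x_2,\ldots)$. Fix $\lambda\in(0,1)$; $\Sigma$ has the metric $d(\mathbf x,\bar{\mathbf x})=\lambda^{k}$, $k=\min\{j:x_j\ne\bar x_j\}$ (and $d(\mathbf x,\mathbf x)=0$). The dual space is $\Sigma^*=\{\mathbf y=(\ldots,y_1,y_0)\in\{1,\ldots,r\}^{\mathbb N}:\mathbf M(y_{j+1},y_j)=1\ \forall j\ge0\}$, with the analogous metric. Let $\hat\Sigma=\{(\mathbf y,\mathbf x)\in\Sigma^*\times\Sigma:\mathbf M(y_0,x_0)=1\}$, with the metric induced from the product. Define $\tau:\hat\Sigma\to\Sigma$ by $\tau(\mathbf y,\mathbf x)=\tau_{\mathbf y}(\mathbf x)=(y_0,x_0,x_1,\ldots)$. $C^0(\cdot)$ denotes real-valued continuous functions. The set $\mathcal M_0$ of holonomic probabilities is the set of Borel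 probability measures $\hat\mu$ on $\hat\Sigma$ such that $\int_{\hat\Sigma} f(\tau_{\mathbf y}(\mathbf x))\,d\hat\mu(\mathbf y,\mathbf x)=\int_{\hat\Sigma} f(\mathbf x)\,d\hat\mu(\mathbf y,\mathbf x)$ for all $f\in C^0(\Sigma)$. For $A\in C^0(\hat\Sigma)$, $\beta_A=\max_{\hat\mu\in\mathcal M_0}\int_{\hat\Sigma}A\,d\hat\mu$. *)

theory Defs
  imports "HOL-Probability.Probability"
begin

definition sft :: "nat \<Rightarrow> (nat \<Rightarrow> nat \<Rightarrow> nat) \<Rightarrow> (nat \<Rightarrow> nat) set" where
  "sft r M = {x. (\<forall>j. x j \<in> {1..r}) \<and> (\<forall>j. M (x j) (x (Suc j)) = 1)}"

text \<open>A point \<open>(\<dots>, y\<^sub>1, y\<^sub>0)\<close> of the dual space is stored as the function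
  \<open>j \<mapsto> y\<^sub>j\<close>, so the transitions run from index \<open>j + 1\<close> to index \<open>j\<close>.\<close>

definition sft_dual :: "nat \<Rightarrow> (nat \<Rightarrow> nat \<Rightarrow> nat) \<Rightarrow> (nat \<Rightarrow> nat) set" where
  "sft_dual r M = {y. (\<forall>j. y j \<in> {1..r}) \<and> (\<forall>j. M (y (Suc j)) (y j) = 1)}"

definition sft_hat :: "nat \<Rightarrow> (nat \<Rightarrow> nat \<Rightarrow> nat) \<Rightarrow> ((nat \<Rightarrow> nat) \<times> (nat \<Rightarrow> nat)) set" where
  "sft_hat r M = {(y, x). y \<in> sft_dual r M \<and> x \<in> sft r M \<and> M (y 0) (x 0) = 1}"

definition tau :: "(nat \<Rightarrow> nat) \<times> (nat \<Rightarrow> nat) \<Rightarrow> (nat \<Rightarrow> nat)" where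
  "tau p = case_nat (fst p 0) (snd p)"

lemma tau_in_sft: "p \<in> sft_hat r M \<Longrightarrow> tau p \<in> sft r M"
proof -
  assume p: "p \<in> sft_hat r M"
  obtain y x where [simp]: "p = (y, x)" by (cases p)
  have "tau p j \<in> {1..r} \<and> M (tau p j) (tau p (Suc j)) = 1" for j
    using p by (cases j) (simp_all add: sft_hat_def sft_def sft_dual_def tau_def)
  then show ?thesis by (simp add: sft_def)
qed

definition seq_dist :: "real \<Rightarrow> (nat \<Rightarrow> nat) \<Rightarrow> (nat \<Rightarrow> nat) \<Rightarrow> real" where
  "seq_dist l x x' = (if x = x' then 0 else l ^ (LEAST j. x j \<noteq> x' j))"

definition sft_top :: "real \<Rightarrow> nat \<Rightarrow> (nat \<Rightarrow> nat \<Rightarrow> nat) \<Rightarrow> (nat \<Rightarrow> nat) topology" where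
  "sft_top l r M = Metric_space.mtopology (sft r M) (seq_dist l)"

definition sft_hat_top ::
    "real \<Rightarrow> nat \<Rightarrow> (nat \<Rightarrow> nat \<Rightarrow> nat) \<Rightarrow> ((nat \<Rightarrow> nat) \<times> (nat \<Rightarrow> nat)) topology" where
  "sft_hat_top l r M =
     Metric_space.mtopology (sft_hat r M) (prod_dist (seq_dist l) (seq_dist l))"

lemma Metric_space_seq_dist:
  assumes "0 < l" "l < 1"
  shows "Metric_space S (seq_dist l)"
proof
  show nonneg: "0 \<le> seq_dist l x y" for x y
    using assms by (simp add: seq_dist_def)
  show "seq_dist l x y = seq_dist l y x" for x y
  proof -
    have "(\<lambda>j. x j \<noteq> y j) = (\<lambda>j. y j \<noteq> x j)" by (rule ext) auto
    moreover have "x = y \<longleftrightarrow> y = x" by auto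
    ultimately show ?thesis unfolding seq_dist_def by presburger
  qed
  show "seq_dist l x y = 0 \<longleftrightarrow> x = y" for x y
    using assms by (simp add: seq_dist_def)
  show "seq_dist l x z \<le> seq_dist l x y + seq_dist l y z" for x y z
  proof (cases "x = y \<or> y = z \<or> x = z")
    case True
    then show ?thesis
    proof (elim disjE)
      assume "x = z"
      then show ?thesis using nonneg by (simp add: seq_dist_def [of l z z])
    qed (use assms in \<open>simp_all add: seq_dist_def [of l z z] seq_dist_def [of l y y]\<close>)
  next
    case False
    define k where "k = (LEAST j. x j \<noteq> z j)"
    have "\<exists>j. x j \<noteq> z j"
      using False by (metis ext)
    then have "x k \<noteq> z k"
      unfolding k_def by (rule LeastI_ex)
    then consider "x k \<noteq> y k" | "y k \<noteq> z k" by metis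
    then show ?thesis
    proof cases
      case 1
      then have "(LEAST j. x j \<noteq> y j) \<le> k" by (rule Least_le)
      then have "l ^ k \<le> l ^ (LEAST j. x j \<noteq> y j)"
        using assms by (intro power_decreasing) auto
      moreover have "0 \<le> l ^ (LEAST j. y j \<noteq> z j)"
        using assms by simp
      ultimately show ?thesis
        using False by (simp add: seq_dist_def k_def)
    next
      case 2
      then have "(LEAST j. y j \<noteq> z j) \<le> k" by (rule Least_le)
      then have "l ^ k \<le> l ^ (LEAST j. y j \<noteq> z j)"
        using assms by (intro power_decreasing) auto
      moreover have "0 \<le> l ^ (LEAST j. x j \<noteq> y j)"
        using assms by simp
      ultimately show ?thesis
        using False by (simp add: seq_dist_def k_def)
    qed
  qed
qed

lemma Metric_space_prod_seq_dist:
  assumes "0 < l" "l < 1"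
  shows "Metric_space S (prod_dist (seq_dist l) (seq_dist l))"
proof -
  interpret Metric_space12 UNIV "seq_dist l" UNIV "seq_dist l"
    using assms by (simp add: Metric_space12_def Metric_space_seq_dist)
  show ?thesis
    by (rule Metric_space.subspace[OF Prod_metric.Metric_space_axioms]) simp
qed

lemma topspace_sft_top: "0 < l \<Longrightarrow> l < 1 \<Longrightarrow> topspace (sft_top l r M) = sft r M"
  unfolding sft_top_def
  by (intro Metric_space.topspace_mtopology Metric_space_seq_dist)

lemma topspace_sft_hat_top: "0 < l \<Longrightarrow> l < 1 \<Longrightarrow> topspace (sft_hat_top l r M) = sft_hat r M"
  unfolding sft_hat_top_def
  by (intro Metric_space.topspace_mtopology Metric_space_prod_seq_dist)


definition C0 :: "'a topology \<Rightarrow> ('a \<Rightarrow> real) set" where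
  "C0 X = {f. continuous_map X euclideanreal f}"

definition borel_of_top :: "'a topology \<Rightarrow> 'a measure" where
  "borel_of_top X = sigma (topspace X) {U. openin X U}"

definition holonomic ::
    "real \<Rightarrow> nat \<Rightarrow> (nat \<Rightarrow> nat \<Rightarrow> nat) \<Rightarrow> ((nat \<Rightarrow> nat) \<times> (nat \<Rightarrow> nat)) measure set" where
  "holonomic l r M =
     {\<mu>. prob_space \<mu> \<and> sets \<mu> = sets (borel_of_top (sft_hat_top l r M)) \<and>
         (\<forall>f\<in>C0 (sft_top l r M). (\<integral>p. f (tau p) \<partial>\<mu>) = (\<integral>p. f (snd p) \<partial>\<mu>))}"

text \<open>The maximum, literally the greatest value, of \<open>g\<close> over \<open>S\<close>; a meaningful value only if \<^term>\<open>has_max g S\<close>.\<close>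

definition has_max :: "('a \<Rightarrow> real) \<Rightarrow> 'a set \<Rightarrow> bool" where
  "has_max g S \<longleftrightarrow> (\<exists>p\<in>S. \<forall>q\<in>S. g q \<le> g p)"

definition max_over :: "('a \<Rightarrow> real) \<Rightarrow> 'a set \<Rightarrow> real" where
  "max_over g S = (GREATEST b. b \<in> g ` S)"

lemma max_over_eq: "p \<in> S \<Longrightarrow> (\<And>q. q \<in> S \<Longrightarrow> g q \<le> g p) \<Longrightarrow> max_over g S = g p"
  unfolding max_over_def by (rule Greatest_equality) auto

definition beta ::
    "real \<Rightarrow> nat \<Rightarrow> (nat \<Rightarrow> nat \<Rightarrow> nat) \<Rightarrow> ((nat \<Rightarrow> nat) \<times> (nat \<Rightarrow> nat) \<Rightarrow> real) \<Rightarrow> real" where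
  "beta l r M A = max_over (\<lambda>\<mu>. \<integral>p. A p \<partial>\<mu>) (holonomic l r M)"

end

theory Submission
  imports Defs
begin

text \<open>
  The infimum is a linear programming dual of the maximum. One inequality is immediate: integrating
  \<open>A + f \<circ> snd - f \<circ> tau\<close> against a holonomic probability gives the integral of \<open>A\<close>, so every
  integral is at most every maximum (\<open>holonomic_integral_le\<close>).

  For the converse, both sides are compared with the best averages of \<open>A\<close> along orbits of the
  inverse branches. Let \<open>V\<^sub>n(x)\<close> be the greatest value of
  \<open>A(p\<^sub>0) + \<dots> + A(p\<^sub>n\<^sub>-\<^sub>1)\<close> over sequences in \<open>sft_hat\<close> with \<open>snd p\<^sub>0 = x\<close> and
  \<open>snd p\<^sub>i\<^sub>+\<^sub>1 = tau p\<^sub>i\<close> (\<open>best_sum\<close>).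

  \<^item> The function \<open>f\<^sub>n = - (V\<^sub>0 + \<dots> + V\<^sub>n\<^sub>-\<^sub>1) / n\<close> is continuous, and the dynamic programming inequality
    for the \<open>V\<^sub>k\<close> telescopes to \<open>A + f\<^sub>n \<circ> snd - f\<^sub>n \<circ> tau \<le> (V\<^sub>n \<circ> snd) / n\<close>
    (\<open>averaged_best_sums_bound\<close>). So the infimum is at most \<open>V\<^sub>n(x\<^sub>n) / n\<close>, where \<open>x\<^sub>n\<close> is the second
    component of a maximiser of the left-hand side.

  \<^item> \<open>V\<^sub>n(x\<^sub>n) / n\<close> is the integral of \<open>A\<close> against the empirical measure of an orbit
    (\<open>best_sum_attained_along_orbit\<close>). Empirical measures of orbits of length \<open>n\<close> are holonomic up
    to an error of order \<open>1 / n\<close>, so a weak limit of them is a holonomic probability whose integral of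
    \<open>A\<close> is at least the infimum (\<open>optimal_holonomic_measure\<close>). It attains the maximum and gives
    equality.

  Weak limits are extracted on the real line, by Helly's theorem: the compact space \<open>sft_hat\<close> embeds
  in the line as a Cantor set through digit expansions (\<open>sft_hat_embeds_in_real\<close>,
  \<open>empirical_averages_converge\<close>).
\<close>


section \<open>Topology of the shift spaces\<close>

text \<open>Distance less than \<open>l ^ n\<close> forces agreement in coordinate \<open>n\<close>, and agreement below \<open>n\<close> forces
  distance at most \<open>l ^ n\<close>, so balls and cylinders are cofinal in each other. From here on the metric
  disappears: continuity and compactness are those of the product topology on \<^typ>\<open>nat \<Rightarrow> nat\<close>.\<close>

lemma mtopology_seq_dist_UNIV:
  assumes "0 < l" "l < 1"
  shows "Metric_space.mtopology UNIV (seq_dist l) = (euclidean :: (nat \<Rightarrow> nat) topology)"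
proof -
  interpret Metric_space UNIV "seq_dist l"
    using assms by (rule Metric_space_seq_dist)
  have near: "x j = y j" if "seq_dist l x y < l ^ j" for x y :: "nat \<Rightarrow> nat" and j
  proof (rule ccontr)
    assume neq: "x j \<noteq> y j"
    then have "(LEAST i. x i \<noteq> y i) \<le> j"
      by (rule Least_le)
    then have "l ^ j \<le> l ^ (LEAST i. x i \<noteq> y i)"
      using assms by (intro power_decreasing) auto
    moreover have "x \<noteq> y"
      using neq by auto
    ultimately show False
      using that by (simp add: seq_dist_def)
  qed
  have agree: "seq_dist l x y \<le> l ^ n" if eq: "\<forall>j<n. y j = x j" for x y :: "nat \<Rightarrow> nat" and n
  proof (cases "x = y")
    case False
    then have "\<exists>j. x j \<noteq> y j"
      by auto
    then have "x (LEAST j. x j \<noteq> y j) \<noteq> y (LEAST j. x j \<noteq> y j)"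
      by (rule LeastI_ex)
    then have "n \<le> (LEAST j. x j \<noteq> y j)"
      using eq by (metis linorder_not_le)
    then show ?thesis
      using False assms by (auto simp: seq_dist_def intro!: power_decreasing)
  qed (use assms in \<open>simp add: seq_dist_def\<close>)
  have "continuous_map mtopology (euclidean :: (nat \<Rightarrow> nat) topology) (\<lambda>x. x)"
  proof -
    have "continuous_map mtopology euclidean (\<lambda>x. x i)" for i :: nat
      unfolding continuous_map_def
    proof (intro conjI allI impI)
      fix U :: "nat set"
      show "openin mtopology {x \<in> topspace mtopology. x i \<in> U}"
        unfolding openin_mtopology
      proof (intro conjI allI impI)
        fix x assume x: "x \<in> {x \<in> topspace mtopology. x i \<in> U}"
        then have "mball x (l ^ i) \<subseteq> {x \<in> topspace mtopology. x i \<in> U}"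
          using near[of x _ i] by (auto simp: mball_def)
        then show "\<exists>e>0. mball x e \<subseteq> {x \<in> topspace mtopology. x i \<in> U}"
          using assms(1) by (intro exI[of _ "l ^ i"]) simp
      qed auto
    qed auto
    then show ?thesis
      by (subst euclidean_product_topology[symmetric]) (simp add: continuous_map_componentwise_UNIV)
  qed
  then have 1: "openin mtopology U" if "open U" for U
    using openin_continuous_map_preimage[OF \<open>continuous_map mtopology euclidean (\<lambda>x. x)\<close>, of U] that
    by simp
  have 2: "open U" if U: "openin mtopology U" for U :: "(nat \<Rightarrow> nat) set"
  proof (subst open_subopen, intro ballI)
    fix x assume "x \<in> U"
    then obtain e where e: "e > 0" "mball x e \<subseteq> U"
      using U by (auto simp: openin_mtopology)
    obtain n where n: "l ^ n < e"
      using real_arch_pow_inv[of e l] e assms by auto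
    define C where "C = (\<Inter>j\<in>{..<n}. (\<lambda>y. y j) -` {x j})"
    have "open C"
      unfolding C_def
      by (intro open_INT ballI open_vimage continuous_on_product_coordinates) (auto simp: Topological_Spaces.open_discrete)
    moreover have "C \<subseteq> mball x e"
    proof
      fix y assume "y \<in> C"
      then show "y \<in> mball x e"
        using agree[of n y x] n by (simp add: C_def)
    qed
    ultimately show "\<exists>T. open T \<and> x \<in> T \<and> T \<subseteq> U"
      using e by (intro exI[of _ C]) (auto simp: C_def)
  qed
  show ?thesis
    unfolding topology_eq using 1 2 open_openin by blast
qed

lemma sft_top_eq:
  assumes "0 < l" "l < 1"
  shows "sft_top l r M = top_of_set (sft r M)"
proof -
  interpret Submetric UNIV "seq_dist l" "sft r M"
    using assms by (simp add: Submetric_def Submetric_axioms_def Metric_space_seq_dist)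
  show ?thesis
    unfolding sft_top_def mtopology_submetric mtopology_seq_dist_UNIV[OF assms] ..
qed

lemma sft_hat_top_eq:
  assumes "0 < l" "l < 1"
  shows "sft_hat_top l r M = top_of_set (sft_hat r M)"
proof -
  interpret P: Metric_space12 "UNIV :: (nat \<Rightarrow> nat) set" "seq_dist l" "UNIV :: (nat \<Rightarrow> nat) set" "seq_dist l"
    using assms by (simp add: Metric_space12_def Metric_space_seq_dist)
  interpret Submetric UNIV "prod_dist (seq_dist l) (seq_dist l)" "sft_hat r M"
    using assms by (simp add: Submetric_def Submetric_axioms_def Metric_space_prod_seq_dist)
  have "mtopology = euclidean"
    using P.mtopology_prod_metric
    by (simp only: mtopology_seq_dist_UNIV[OF assms] prod_topology_euclidean UNIV_Times_UNIV)
  then show ?thesis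
    by (simp only: sft_hat_top_def mtopology_submetric)
qed

text \<open>The coordinates take values in a discrete space, so the condition is even clopen. It is used for the
  transition rules of the shift spaces, one pair of neighbouring coordinates at a time.\<close>

lemma closed_coordinate_relation:
  fixes u v :: "'a::topological_space \<Rightarrow> nat"
  assumes "continuous_on UNIV u" "continuous_on UNIV v"
  shows "closed {p. P (u p) (v p)}"
proof -
  have "{p. P (u p) (v p)} = (\<lambda>p. (u p, v p)) -` {(a, b). P a b}"
    by auto
  moreover have "open S" for S :: "(nat \<times> nat) set"
    unfolding open_prod_def
  proof
    fix x assume "x \<in> S"
    then show "\<exists>A B. open A \<and> open B \<and> x \<in> A \<times> B \<and> A \<times> B \<subseteq> S"
      by (rule_tac exI[where x = "{fst x}"], rule_tac exI[where x = "{snd x}"])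
        (auto simp: Topological_Spaces.open_discrete)
  qed
  then have "closed {(a :: nat, b :: nat). P a b}"
    by (simp add: closed_def)
  ultimately show ?thesis
    by (simp only:) (intro closed_vimage continuous_on_Pair assms)
qed

lemma compact_bounded_sequences: "compact {x :: nat \<Rightarrow> nat. \<forall>j. x j \<in> {1..r}}"
proof -
  have "compactin (product_topology (\<lambda>i :: nat. euclidean) UNIV) (\<Pi>\<^sub>E i\<in>UNIV. {1..r :: nat})"
    by (subst compactin_PiE) (simp add: finite_imp_compact)
  then show ?thesis
    by (simp add: euclidean_product_topology PiE_def Pi_def)
qed

lemma sft_as_Int: "sft r M = {x. \<forall>j. x j \<in> {1..r}} \<inter> (\<Inter>j. {x. M (x j) (x (Suc j)) = 1})"
  by (auto simp: sft_def)

lemma compact_sft: "compact (sft r M)"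
  unfolding sft_as_Int
  by (intro compact_Int_closed compact_bounded_sequences closed_INT ballI
      closed_coordinate_relation[where P = "\<lambda>a b. M a b = 1"] continuous_on_product_coordinates)

lemma sft_dual_as_Int:
  "sft_dual r M = {y. \<forall>j. y j \<in> {1..r}} \<inter> (\<Inter>j. {y. M (y (Suc j)) (y j) = 1})"
  by (auto simp: sft_dual_def)

lemma compact_sft_dual: "compact (sft_dual r M)"
  unfolding sft_dual_as_Int
  by (intro compact_Int_closed compact_bounded_sequences closed_INT ballI
      closed_coordinate_relation[where P = "\<lambda>a b. M a b = 1"] continuous_on_product_coordinates)

lemma continuous_on_fst_coordinate:
  "continuous_on S (\<lambda>p :: (nat \<Rightarrow> nat) \<times> (nat \<Rightarrow> nat). fst p j)"
  by (rule continuous_on_product_then_coordinatewise) (rule continuous_on_fst[OF continuous_on_id])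

lemma continuous_on_snd_coordinate:
  "continuous_on S (\<lambda>p :: (nat \<Rightarrow> nat) \<times> (nat \<Rightarrow> nat). snd p j)"
  by (rule continuous_on_product_then_coordinatewise) (rule continuous_on_snd[OF continuous_on_id])

lemma compact_sft_hat: "compact (sft_hat r M)"
proof -
  have "sft_hat r M = sft_dual r M \<times> sft r M \<inter> {p. M (fst p 0) (snd p 0) = 1}"
    by (auto simp: sft_hat_def)
  moreover have closed: "closed {p :: (nat \<Rightarrow> nat) \<times> (nat \<Rightarrow> nat). M (fst p 0) (snd p 0) = 1}"
    by (rule closed_coordinate_relation[where P = "\<lambda>a b. M a b = 1",
          OF continuous_on_fst_coordinate continuous_on_snd_coordinate])
  ultimately show ?thesis
    using compact_Int_closed[OF compact_Times[OF compact_sft_dual compact_sft] closed] by simp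
qed

lemma continuous_on_tau: "continuous_on S tau"
proof (rule continuous_on_coordinatewise_then_product)
  show "continuous_on S (\<lambda>p. tau p j)" for j
    by (cases j) (simp_all add: tau_def continuous_on_fst_coordinate continuous_on_snd_coordinate)
qed

lemma snd_in_sft: "p \<in> sft_hat r M \<Longrightarrow> snd p \<in> sft r M"
  by (auto simp: sft_hat_def)

lemma continuous_on_compose_tau:
  "continuous_on (sft r M) f \<Longrightarrow> continuous_on (sft_hat r M) (\<lambda>p. f (tau p))"
  by (rule continuous_on_compose2[OF _ continuous_on_tau]) (auto intro: tau_in_sft)

lemma continuous_on_compose_snd:
  "continuous_on (sft r M) f \<Longrightarrow> continuous_on (sft_hat r M) (\<lambda>p. f (snd p))"
  by (rule continuous_on_compose2[OF _ continuous_on_snd[OF continuous_on_id]])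
    (auto intro: snd_in_sft)

text \<open>The difficulty is the past: an arbitrary \<open>x\<close> in the shift may start with a symbol that has no
  infinite past. By the pigeonhole principle \<open>x\<close> repeats a symbol, so it runs along a cycle of the
  transition graph, and a symbol on a cycle does have an infinite past.\<close>

lemma sft_hat_nonempty:
  assumes "sft r M \<noteq> {}"
  shows "sft_hat r M \<noteq> {}"
proof -
  obtain x where x: "x \<in> sft r M"
    using assms by auto
  have "\<not> inj x"
  proof
    assume "inj x"
    moreover have "range x \<subseteq> {1..r}"
      using x by (auto simp: sft_def)
    then have "finite (range x)"
      by (rule finite_subset) simp
    ultimately show False
      using finite_imageD infinite_UNIV_nat by blast
  qed
  then obtain i k where ik: "i < k" "x i = x k"
    by (metis injI linorder_neqE_nat)
  \<comment> \<open>The past runs backwards and forever around the cycle \<open>x\<^sub>i, \<dots>, x\<^sub>k = x\<^sub>i\<close>, so it can be placed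
    before the future that starts at time \<open>k\<close>.\<close>
  define m where "m = k - i"
  have m: "m > 0" "k = i + m"
    using ik by (auto simp: m_def)
  define y where "y j = x (i + (m - 1 - j mod m))" for j
  have edge: "M (x j) (x (Suc j)) = 1" for j
    using x by (auto simp: sft_def)
  have "M (y (Suc j)) (y j) = 1" for j
  proof (cases "Suc (j mod m) = m")
    case True
    then have "y (Suc j) = x (i + (m - 1))" "y j = x i"
      by (auto simp: y_def mod_Suc)
    then show ?thesis
      using edge[of "i + (m - 1)"] ik m by simp
  next
    case False
    moreover have "j mod m < m"
      using m by simp
    ultimately have "i + (m - 1 - j mod m) = Suc (i + (m - 1 - Suc j mod m))"
      by (simp add: mod_Suc)
    then have "y j = x (Suc (i + (m - 1 - Suc j mod m)))"
      by (simp only: y_def)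
    then show ?thesis
      using edge by (simp add: y_def)
  qed
  moreover have "y j \<in> {1..r}" for j
    using x by (simp add: y_def sft_def)
  moreover have "M (y 0) (x k) = 1"
    using edge[of "i + (m - 1)"] m by (simp add: y_def)
  moreover have "(\<lambda>j. x (k + j)) \<in> sft r M"
    using x by (auto simp: sft_def)
  ultimately have "(y, \<lambda>j. x (k + j)) \<in> sft_hat r M"
    by (auto simp: sft_hat_def sft_dual_def)
  then show ?thesis
    by auto
qed

text \<open>Dropping the symbol \<open>y\<^sub>0\<close> from the past after moving it to the front of the future gives an
  admissible pair, so orbits of the inverse branches can be continued forever.\<close>

lemma sft_hat_successor:
  assumes "p \<in> sft_hat r M"
  obtains q where "q \<in> sft_hat r M" "snd q = tau p"
proof
  show "(\<lambda>j. fst p (Suc j), tau p) \<in> sft_hat r M"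
    using assms tau_in_sft[OF assms] by (auto simp: sft_hat_def sft_dual_def tau_def)
qed simp


section \<open>Digit expansions embed bounded sequences into the real line\<close>

text \<open>The base exceeds the digit bound \<open>N\<close> by two rather than one. This makes the fractional tail
  strictly less than one, which excludes the double representations such as \<open>0.999\<dots> = 1\<close>.\<close>

definition expansion :: "nat \<Rightarrow> (nat \<Rightarrow> nat) \<Rightarrow> real" where
  "expansion N c = (\<Sum>j. real (c j) / (real N + 2) ^ j)"

lemma sums_expansion_bound: "(\<lambda>j. real N / (real N + 2) ^ j) sums (real N * (real N + 2) / (real N + 1))"
proof -
  have "(\<lambda>j. (1 / (real N + 2)) ^ j) sums (1 / (1 - 1 / (real N + 2)))"
    by (rule geometric_sums) simp
  then have "(\<lambda>j. real N * (1 / (real N + 2)) ^ j) sums (real N * (1 / (1 - 1 / (real N + 2))))"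
    by (rule sums_mult)
  moreover have "1 / (1 - 1 / (real N + 2)) = (real N + 2) / (real N + 1)"
    by (simp add: field_simps)
  ultimately show ?thesis
    by (simp add: power_one_over)
qed

lemma expansion_term_bound: "m \<le> N \<Longrightarrow> norm (real m / (real N + 2) ^ j) \<le> real N / (real N + 2) ^ j"
  by (simp add: divide_right_mono)

lemma summable_expansion:
  assumes "\<And>j. c j \<le> N"
  shows "summable (\<lambda>j. real (c j) / (real N + 2) ^ j)"
  by (rule summable_comparison_test'[OF sums_summable[OF sums_expansion_bound]])
    (rule expansion_term_bound[OF assms])

lemma expansion_nonneg: "(\<And>j. c j \<le> N) \<Longrightarrow> 0 \<le> expansion N c"
  unfolding expansion_def by (intro suminf_nonneg summable_expansion) auto

lemma expansion_less:
  assumes "\<And>j. c j \<le> N"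
  shows "expansion N c < real N + 2"
proof -
  have "expansion N c \<le> real N * (real N + 2) / (real N + 1)"
    unfolding expansion_def sums_unique[OF sums_expansion_bound]
    using expansion_term_bound[OF assms]
    by (intro suminf_le summable_expansion sums_summable[OF sums_expansion_bound] assms) auto
  also have "\<dots> < real N + 2"
    by (simp add: field_simps)
  finally show ?thesis .
qed

lemma expansion_shift:
  assumes "\<And>j. c j \<le> N"
  shows "expansion N c = real (c 0) + expansion N (\<lambda>j. c (Suc j)) / (real N + 2)"
proof -
  have "expansion N c - real (c 0) = (\<Sum>j. real (c (Suc j)) / (real N + 2) ^ j / (real N + 2))"
    using suminf_split_head[OF summable_expansion[of c N], OF assms]
    by (simp add: expansion_def mult.commute)
  also have "\<dots> = expansion N (\<lambda>j. c (Suc j)) / (real N + 2)"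
    unfolding expansion_def by (rule suminf_divide) (rule summable_expansion, rule assms)
  finally show ?thesis
    by simp
qed

text \<open>The leading digit is the integer part of the expansion; removing it leaves the expansion of the
  shifted sequence, divided by the base.\<close>

lemma expansion_eq_imp_eq:
  assumes "\<And>j. c j \<le> N" "\<And>j. c' j \<le> N" "expansion N c = expansion N c'"
  shows "c j = c' j"
  using assms
proof (induction j arbitrary: c c')
  have head: "c 0 = nat \<lfloor>expansion N c\<rfloor>" if c: "\<And>j. c j \<le> N" for c
  proof -
    have "0 \<le> expansion N (\<lambda>j. c (Suc j)) / (real N + 2)"
      using expansion_nonneg[of "\<lambda>j. c (Suc j)" N] c by simp
    moreover have "expansion N (\<lambda>j. c (Suc j)) / (real N + 2) < 1"
      using expansion_less[of "\<lambda>j. c (Suc j)" N] c by simp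
    ultimately have "\<lfloor>expansion N c\<rfloor> = int (c 0)"
      using expansion_shift[of c N] c by (simp add: floor_eq_iff)
    then show ?thesis
      by simp
  qed
  then have heads: "c 0 = c' 0"
    if "\<And>j. c j \<le> N" "\<And>j. c' j \<le> N" "expansion N c = expansion N c'" for c c'
    using that by metis
  {
    case 0
    then show ?case
      by (rule heads)
  next
    case (Suc j)
    have "expansion N (\<lambda>j. c (Suc j)) / (real N + 2) = expansion N (\<lambda>j. c' (Suc j)) / (real N + 2)"
      using expansion_shift[of c N, OF Suc.prems(1)] expansion_shift[of c' N, OF Suc.prems(2)] heads[OF Suc.prems]
        Suc.prems(3) by linarith
    then have "expansion N (\<lambda>j. c (Suc j)) = expansion N (\<lambda>j. c' (Suc j))"
      by simp
    then show ?case
      by (rule Suc.IH[OF Suc.prems(1,2)])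
  }
qed

lemma continuous_on_expansion:
  fixes c :: "'a::topological_space \<Rightarrow> nat \<Rightarrow> nat"
  assumes "\<And>j. continuous_on K (\<lambda>p. real (c p j))" "\<And>p j. p \<in> K \<Longrightarrow> c p j \<le> N"
  shows "continuous_on K (\<lambda>p. expansion N (c p))"
proof (rule uniform_limit_theorem)
  show "uniform_limit K (\<lambda>n p. \<Sum>j<n. real (c p j) / (real N + 2) ^ j)
      (\<lambda>p. expansion N (c p)) sequentially"
    unfolding expansion_def
    by (rule Weierstrass_m_test[OF expansion_term_bound[OF assms(2)]
        sums_summable[OF sums_expansion_bound]])
  show "\<forall>\<^sub>F n in sequentially. continuous_on K (\<lambda>p. \<Sum>j<n. real (c p j) / (real N + 2) ^ j)"
    by (intro always_eventually allI continuous_intros assms(1)) auto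
qed simp

text \<open>Both sequences are packed into one by writing the pair of \<open>j\<close>-th symbols as the single digit
  \<open>y\<^sub>j (r + 1) + x\<^sub>j\<close>.\<close>

lemma sft_hat_embeds_in_real:
  obtains \<phi> :: "(nat \<Rightarrow> nat) \<times> (nat \<Rightarrow> nat) \<Rightarrow> real"
  where "continuous_on (sft_hat r M) \<phi>" "inj_on \<phi> (sft_hat r M)"
proof
  define c :: "(nat \<Rightarrow> nat) \<times> (nat \<Rightarrow> nat) \<Rightarrow> nat \<Rightarrow> nat"
    where "c p j = fst p j * Suc r + snd p j" for p j
  define N where "N = r * Suc r + r"
  have bound: "fst p j \<le> r" "snd p j \<le> r" if "p \<in> sft_hat r M" for p j
    using that by (auto simp: sft_hat_def sft_def sft_dual_def)
  have digit: "c p j div Suc r = fst p j" "c p j mod Suc r = snd p j" if "p \<in> sft_hat r M" for p j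
    using bound[OF that, of j] by (simp_all add: c_def del: mult_Suc_right)
  have cN: "c p j \<le> N" if "p \<in> sft_hat r M" for p j
    unfolding c_def N_def using bound[OF that] by (intro add_mono mult_right_mono) auto
  show "continuous_on (sft_hat r M) (\<lambda>p. expansion N (c p))"
  proof (rule continuous_on_expansion[OF _ cN])
    show "continuous_on (sft_hat r M) (\<lambda>p. real (c p j))" for j
      unfolding c_def of_nat_add of_nat_mult
      by (intro continuous_intros continuous_on_fst_coordinate continuous_on_snd_coordinate)
  qed
  show "inj_on (\<lambda>p. expansion N (c p)) (sft_hat r M)"
  proof (rule inj_onI)
    fix p q assume pq: "p \<in> sft_hat r M" "q \<in> sft_hat r M" "expansion N (c p) = expansion N (c q)"
    have "fst p j = fst q j \<and> snd p j = snd q j" for j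
    proof -
      have "c p j = c q j"
        using expansion_eq_imp_eq[of "c p" N "c q"] cN pq by blast
      then show ?thesis
        using digit[OF pq(1), of j] digit[OF pq(2), of j] by simp
    qed
    then show "p = q"
      by (auto simp: prod_eq_iff)
  qed
qed

section \<open>Weak limits of empirical measures\<close>

lemma space_borel_of_top: "space (borel_of_top X) = topspace X"
  by (simp add: borel_of_top_def space_measure_of_conv)

lemma sets_borel_of_top: "sets (borel_of_top X) = sigma_sets (topspace X) {U. openin X U}"
  unfolding borel_of_top_def by (rule sets_measure_of) (auto dest: openin_subset)

lemma measurable_borel_of_top:
  fixes f :: "'a::topological_space \<Rightarrow> real"
  assumes "continuous_on K f"
  shows "f \<in> borel_measurable (borel_of_top (top_of_set K))"
proof (rule borel_measurableI)
  fix S :: "real set" assume "open S"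
  then have "openin (top_of_set K) (K \<inter> f -` S)"
    using assms by (simp add: continuous_on_open_gen continuous_on_open_invariant continuous_openin_preimage_gen)
  then show "f -` S \<inter> space (borel_of_top (top_of_set K)) \<in> sets (borel_of_top (top_of_set K))"
    by (simp add: space_borel_of_top sets_borel_of_top Int_commute sigma_sets.Basic)
qed

lemma integrable_continuous_on_compact:
  fixes f :: "'a::topological_space \<Rightarrow> real"
  assumes "prob_space \<mu>" "sets \<mu> = sets (borel_of_top (top_of_set K))" "compact K" "continuous_on K f"
  shows "integrable \<mu> f"
proof -
  interpret prob_space \<mu>
    by fact
  have "space \<mu> = K"
    using sets_eq_imp_space_eq[OF assms(2)] by (simp add: space_borel_of_top)
  moreover obtain B where "\<And>x. x \<in> K \<Longrightarrow> \<bar>f x\<bar> \<le> B"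
    using compact_imp_bounded[OF compact_continuous_image[OF assms(4,3)]] by (auto simp: bounded_iff)
  moreover have "f \<in> borel_measurable \<mu>"
    using measurable_borel_of_top[OF assms(4)] measurable_cong_sets[OF assms(2) refl] by blast
  ultimately show ?thesis
    by (intro integrable_const_bound[where B = B]) (auto simp: AE_I2)
qed

text \<open>Sequential weak compactness for empirical measures on a compact space that embeds in the real line.
  The embedding transports the measures to the line, where all of them live on the compact set
  \<open>\<phi> ` K\<close> and are therefore tight, so Helly's theorem gives a weak limit. The limit is carried by \<open>\<phi> ` K\<close>
  and can be pulled back; continuous functions on \<open>K\<close> are tested through Tietze extensions of
  their transports.\<close>

lemma empirical_averages_converge:
  fixes K :: "'a::topological_space set" and \<phi> :: "'a \<Rightarrow> real"
  assumes K: "compact K" and \<phi>: "continuous_on K \<phi>" "inj_on \<phi> K"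
    and z: "\<And>n i. z n i \<in> K"
  obtains s \<mu> where "strict_mono s" "prob_space \<mu>" "sets \<mu> = sets (borel_of_top (top_of_set K))"
    "\<And>g :: 'a \<Rightarrow> real. continuous_on K g \<Longrightarrow>
      (\<lambda>n. (\<Sum>i<Suc (s n). g (z (s n) i)) / real (Suc (s n))) \<longlonglongrightarrow> (\<integral>p. g p \<partial>\<mu>)"
proof -
  define L where "L = \<phi> ` K"
  have "compact L"
    unfolding L_def by (rule compact_continuous_image[OF \<phi>(1) K])
  then have "closed L" "bounded L"
    by (auto simp: compact_imp_closed compact_imp_bounded)
  \<comment> \<open>The uniform distribution on the \<open>n + 1\<close> images \<open>\<phi> (z n i)\<close>, \<open>i \<le> n\<close>.\<close>
  define \<nu> where "\<nu> n = distr (measure_pmf (pmf_of_set {..<Suc n})) borel (\<lambda>i. \<phi> (z n i))" for n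
  have \<nu>_integral: "(\<integral>t. h t \<partial>\<nu> n) = (\<Sum>i<Suc n. h (\<phi> (z n i))) / real (Suc n)"
    if "continuous_on UNIV h" for h :: "real \<Rightarrow> real" and n
    unfolding \<nu>_def using borel_measurable_continuous_onI[OF that]
    by (subst integral_distr) (auto simp: integral_pmf_of_set lessThan_empty_iff)
  have "tight \<nu>"
    unfolding tight_def
  proof (intro conjI allI impI)
    show real_distribution: "real_distribution (\<nu> n)" for n
      unfolding \<nu>_def real_distribution_def real_distribution_axioms_def
      by (auto intro!: prob_space.prob_space_distr measure_pmf.prob_space_axioms)
    fix e :: real assume "e > 0"
    obtain B where B: "\<And>t. t \<in> L \<Longrightarrow> \<bar>t\<bar> \<le> B" "B > 0"
      using \<open>bounded L\<close> by (auto simp: bounded_pos)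
    have "measure (\<nu> n) {- B - 1<..B} = 1" for n
    proof -
      have "(\<lambda>i. \<phi> (z n i)) -` {- B - 1<..B} = UNIV"
      proof (intro set_eqI iffI UNIV_I)
        fix i
        have "\<bar>\<phi> (z n i)\<bar> \<le> B"
          using B(1) z by (simp add: L_def)
        then show "i \<in> (\<lambda>i. \<phi> (z n i)) -` {- B - 1<..B}"
          by (simp add: abs_le_iff)
      qed
      then show ?thesis
        by (simp add: \<nu>_def measure_distr)
    qed
    then show "\<exists>a b. a < b \<and> (\<forall>n. 1 - e < measure (\<nu> n) {a<..b})"
      using \<open>e > 0\<close> B(2) by (intro exI[of _ "- B - 1"] exI[of _ B]) auto
  qed
  then obtain s N where s: "strict_mono s" and N: "real_distribution N"
    and weak: "weak_conv_m (\<nu> \<circ> s) N"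
    using tight_imp_convergent_subsubsequence[OF _ strict_mono_id, of \<nu>] by auto
  have \<nu>_dist: "real_distribution (\<nu> n)" for n
    using \<open>tight \<nu>\<close> by (simp add: tight_def)
  interpret N: real_distribution N
    by fact
  have converge: "(\<lambda>n. (\<Sum>i<Suc (s n). h (\<phi> (z (s n) i))) / real (Suc (s n))) \<longlonglongrightarrow> (\<integral>t. h t \<partial>N)"
    if h: "continuous_on UNIV h" "\<And>t. \<bar>h t\<bar> \<le> B" for h B
  proof -
    have "(\<lambda>n. \<integral>t. h t \<partial>((\<nu> \<circ> s) n)) \<longlonglongrightarrow> (\<integral>t. h t \<partial>N)"
      using h by (intro weak_conv_imp_integral_bdd_continuous_conv[OF _ N weak, of h B])
        (auto simp: \<nu>_dist continuous_on_eq_continuous_at)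
    then show ?thesis
      by (simp add: \<nu>_integral[OF h(1)])
  qed
  \<comment> \<open>The truncated distance to \<open>L\<close> is a bounded continuous function that vanishes on every \<open>\<phi> (z n i)\<close>,
    hence its integral against the limit is zero.\<close>
  have AE_L: "AE t in N. t \<in> L"
  proof -
    define h where "h t = min 1 (infdist t L)" for t
    have h: "continuous_on UNIV h" "0 \<le> h t" "\<bar>h t\<bar> \<le> 1" for t
      unfolding h_def by (auto intro!: continuous_intros simp: infdist_nonneg)
    have "h (\<phi> (z n i)) = 0" for n i
      using z by (simp add: h_def L_def)
    then have "(\<integral>t. h t \<partial>N) = 0"
      using converge[OF h(1,3)] by (simp add: LIMSEQ_const_iff)
    moreover have "h \<in> borel_measurable N"
      using borel_measurable_continuous_onI[OF h(1)] by simp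
    then have "integrable N h"
      by (intro N.integrable_const_bound[where B = 1] AE_I2) (simp_all only: real_norm_def h(3))
    ultimately have "AE t in N. h t = 0"
      using integral_nonneg_eq_0_iff_AE[of N h] h(2) by simp
    moreover have "t \<in> L" if "h t = 0" for t
      using that in_closed_iff_infdist_zero[OF \<open>closed L\<close>, of t] z
      by (force simp: h_def L_def min_def split: if_splits)
    ultimately show ?thesis
      by (auto elim: eventually_mono)
  qed
  \<comment> \<open>The inverse of \<open>\<phi>\<close>, with the arbitrary value \<open>z 0 0\<close> on the null set outside \<open>L\<close>.\<close>
  define \<psi> where "\<psi> t = (if t \<in> L then inv_into K \<phi> t else z 0 0)" for t
  have \<psi>_\<phi>: "\<psi> (\<phi> p) = p" if "p \<in> K" for p
    using that \<phi>(2) by (simp add: \<psi>_def L_def)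
  have \<psi>_K: "\<psi> t \<in> K" for t
    using z by (auto simp: \<psi>_def L_def inv_into_into)
  have \<phi>_\<psi>: "\<phi> (\<psi> t) = t" if "t \<in> L" for t
    using that by (auto simp: \<psi>_def L_def f_inv_into_f)
  have cont_\<psi>: "continuous_on L \<psi>"
    unfolding L_def by (rule continuous_on_inv[OF \<phi>(1) K]) (simp add: \<psi>_\<phi>)
  have \<psi>_measurable: "\<psi> \<in> measurable N (borel_of_top (top_of_set K))"
  proof (rule measurable_sigma_sets[OF sets_borel_of_top])
    fix U assume "U \<in> {U. openin (top_of_set K) U}"
    then obtain T where T: "open T" "U = K \<inter> T"
      by (auto simp: openin_open)
    have "(\<lambda>t. if t \<in> L then \<psi> t else z 0 0) \<in> borel_measurable borel"
      using \<open>closed L\<close> cont_\<psi> by (intro borel_measurable_continuous_on_if) auto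
    moreover have "(\<lambda>t. if t \<in> L then \<psi> t else z 0 0) = \<psi>"
      by (auto simp: \<psi>_def)
    ultimately have "\<psi> \<in> borel_measurable N"
      by simp
    then have "\<psi> -` T \<inter> space N \<in> sets N"
      by (rule measurable_sets[OF _ borel_open[OF T(1)]])
    moreover have "\<psi> -` U = \<psi> -` T"
      using \<psi>_K by (auto simp: T)
    ultimately show "\<psi> -` U \<inter> space N \<in> sets N"
      by simp
  qed (use \<psi>_K in \<open>auto dest!: openin_imp_subset\<close>)
  define \<mu> where "\<mu> = distr N (borel_of_top (top_of_set K)) \<psi>"
  show thesis
  proof (rule that[OF s])
    show "prob_space \<mu>"
      unfolding \<mu>_def by (rule N.prob_space_distr[OF \<psi>_measurable])
    show "sets \<mu> = sets (borel_of_top (top_of_set K))"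
      by (simp add: \<mu>_def)
    fix g :: "'a \<Rightarrow> real" assume g: "continuous_on K g"
    obtain B where B: "\<And>p. p \<in> K \<Longrightarrow> \<bar>g p\<bar> \<le> B"
      using compact_imp_bounded[OF compact_continuous_image[OF g K]] by (auto simp: bounded_iff)
    have "continuous_on L (\<lambda>t. g (\<psi> t))"
      using \<psi>_K by (intro continuous_on_compose2[OF g cont_\<psi>]) auto
    moreover have "0 \<le> B"
      using B[OF z] abs_ge_zero order_trans by blast
    ultimately obtain h where h: "continuous_on UNIV h" "\<And>t. t \<in> L \<Longrightarrow> h t = g (\<psi> t)"
      "\<And>t. \<bar>h t\<bar> \<le> B"
      using Tietze[of L "\<lambda>t. g (\<psi> t)" UNIV B] \<open>closed L\<close> B[OF \<psi>_K] by auto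
    have gm: "g \<in> borel_measurable (borel_of_top (top_of_set K))"
      by (rule measurable_borel_of_top[OF g])
    have "(\<integral>p. g p \<partial>\<mu>) = (\<integral>t. g (\<psi> t) \<partial>N)"
      unfolding \<mu>_def by (rule integral_distr[OF \<psi>_measurable gm])
    also have "\<dots> = (\<integral>t. h t \<partial>N)"
    proof (rule integral_cong_AE)
      show "(\<lambda>t. g (\<psi> t)) \<in> borel_measurable N"
        using measurable_compose[OF \<psi>_measurable gm] .
      show "h \<in> borel_measurable N"
        using borel_measurable_continuous_onI[OF h(1)] by simp
      show "AE t in N. g (\<psi> t) = h t"
        using AE_L by eventually_elim (simp add: h(2))
    qed
    finally have "(\<integral>p. g p \<partial>\<mu>) = (\<integral>t. h t \<partial>N)" .
    moreover have "h (\<phi> (z n i)) = g (z n i)" for n i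
      using z h(2)[of "\<phi> (z n i)"] by (simp add: L_def \<psi>_\<phi>)
    ultimately show "(\<lambda>n. (\<Sum>i<Suc (s n). g (z (s n) i)) / real (Suc (s n))) \<longlonglongrightarrow> (\<integral>p. g p \<partial>\<mu>)"
      using converge[OF h(1,3)] by simp
  qed
qed


section \<open>Greatest sums along orbits\<close>

text \<open>The maximum theorem in the case needed here: near \<open>x\<close> the fibre of \<open>K\<close> is one fixed compact set
  \<open>C\<close>, and \<open>W\<close> is continuous in the second argument uniformly over \<open>C\<close>. An empty \<open>C\<close> is allowed; then
  the supremum is the same unspecified number \<open>Sup {}\<close> for all points near \<open>x\<close>.\<close>

lemma continuous_on_fibre_Sup:
  fixes W :: "'a::topological_space \<times> 'b::topological_space \<Rightarrow> real"
  assumes W: "continuous_on K W"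
    and locally_product: "\<And>x. x \<in> S \<Longrightarrow>
      \<exists>U C. open U \<and> x \<in> U \<and> compact C \<and> (\<forall>x'\<in>S \<inter> U. \<forall>y. (y, x') \<in> K \<longleftrightarrow> y \<in> C)"
  shows "continuous_on S (\<lambda>x. Sup (W ` {p \<in> K. snd p = x}))"
  unfolding continuous_on_def tendsto_iff eventually_at_topological
proof (intro ballI allI impI)
  fix x and e :: real assume x: "x \<in> S" and "e > 0"
  let ?V = "\<lambda>x. Sup (W ` {p \<in> K. snd p = x})"
  obtain U C where U: "open U" "x \<in> U" and C: "compact C"
    and fibre: "\<And>x' y. x' \<in> S \<inter> U \<Longrightarrow> (y, x') \<in> K \<longleftrightarrow> y \<in> C"
    using locally_product[OF x] by metis
  have W': "continuous_on ((S \<inter> U) \<times> C) (\<lambda>q. W (prod.swap q))"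
    using fibre by (intro continuous_on_compose2[OF W continuous_on_swap]) auto
  have "x \<in> S \<inter> U" "0 < e / 2"
    using x U(2) \<open>e > 0\<close> by auto
  then obtain X where X: "x \<in> X" "open X"
    "\<forall>x'\<in>X \<inter> (S \<inter> U). \<forall>y\<in>C. dist (W (prod.swap (x', y))) (W (prod.swap (x, y))) \<le> e / 2"
    by (rule continuous_on_prod_compactE[OF W' C])
  have V: "?V x' = Sup ((\<lambda>y. W (y, x')) ` C)" if "x' \<in> S \<inter> U" for x'
    using fibre[OF that] by (intro arg_cong[where f = Sup]) force
  have bdd: "bdd_above ((\<lambda>y. W (y, x')) ` C)" if "x' \<in> S \<inter> U" for x'
    using fibre[OF that]
    by (intro bounded_imp_bdd_above compact_imp_bounded compact_continuous_image C
        continuous_on_compose2[OF W continuous_on_Pair[OF continuous_on_id continuous_on_const]]) auto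
  have close: "Sup ((\<lambda>y. W (y, u)) ` C) \<le> Sup ((\<lambda>y. W (y, v)) ` C) + e / 2"
    if "C \<noteq> {}" and v: "v \<in> S \<inter> U" and near: "\<And>y. y \<in> C \<Longrightarrow> dist (W (y, u)) (W (y, v)) \<le> e / 2"
    for u v
  proof (rule cSUP_least[OF \<open>C \<noteq> {}\<close>])
    fix y assume y: "y \<in> C"
    then have "W (y, v) \<le> Sup ((\<lambda>y. W (y, v)) ` C)"
      by (rule cSUP_upper[OF _ bdd[OF v]])
    then show "W (y, u) \<le> Sup ((\<lambda>y. W (y, v)) ` C) + e / 2"
      using near[OF y] unfolding dist_real_def by linarith
  qed
  have "dist (?V x') (?V x) < e" if x': "x' \<in> X \<inter> U" "x' \<in> S" for x'
  proof -
    have "\<bar>Sup ((\<lambda>y. W (y, x')) ` C) - Sup ((\<lambda>y. W (y, x)) ` C)\<bar> \<le> e / 2"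
    proof (cases "C = {}")
      case False
      have near: "dist (W (y, x')) (W (y, x)) \<le> e / 2" if "y \<in> C" for y
        using X(3) x' that by simp
      have "Sup ((\<lambda>y. W (y, x')) ` C) \<le> Sup ((\<lambda>y. W (y, x)) ` C) + e / 2"
        using x U(2) near by (intro close[OF False]) auto
      moreover have "Sup ((\<lambda>y. W (y, x)) ` C) \<le> Sup ((\<lambda>y. W (y, x')) ` C) + e / 2"
        using x' near by (intro close[OF False]) (auto simp: dist_commute)
      ultimately show ?thesis
        by linarith
    qed (use \<open>e > 0\<close> in simp)
    then show ?thesis
      using V[of x'] V[of x] x' x U(2) \<open>e > 0\<close> by (simp add: dist_real_def)
  qed
  then show "\<exists>T. open T \<and> x \<in> T \<and> (\<forall>x'\<in>T. x' \<noteq> x \<longrightarrow> x' \<in> S \<longrightarrow> dist (?V x') (?V x) < e)"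
    using X(1,2) U by (intro exI[of _ "X \<inter> U"]) auto
qed

text \<open>The greatest sum of \<open>A\<close> along \<open>k\<close> successive points of an orbit \<open>x, \<tau>\<^sub>y(x), \<dots>\<close> with freely chosen
  pasts: the value function of a control problem, given by its dynamic programming recursion. For
  \<open>k > 0\<close> and a point \<open>x\<close> without admissible past it is \<open>Sup {}\<close>; such points are not second
  components of elements of \<^const>\<open>sft_hat\<close>.\<close>

primrec best_sum ::
    "nat \<Rightarrow> (nat \<Rightarrow> nat \<Rightarrow> nat) \<Rightarrow> ((nat \<Rightarrow> nat) \<times> (nat \<Rightarrow> nat) \<Rightarrow> real) \<Rightarrow> nat \<Rightarrow> (nat \<Rightarrow> nat) \<Rightarrow> real"
where
  "best_sum r M A 0 x = 0"
| "best_sum r M A (Suc k) x =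
    Sup ((\<lambda>p. A p + best_sum r M A k (tau p)) ` {p \<in> sft_hat r M. snd p = x})"

lemma compact_fibre: "compact {y. (y, x) \<in> sft_hat r M}"
proof (cases "x \<in> sft r M")
  case True
  then have "{y. (y, x) \<in> sft_hat r M} = sft_dual r M \<inter> {y. M (y 0) (x 0) = 1}"
    by (auto simp: sft_hat_def)
  moreover have "closed {y :: nat \<Rightarrow> nat. M (y 0) (x 0) = 1}"
    using closed_coordinate_relation[where P = "\<lambda>a b. M a (x 0) = 1",
        OF continuous_on_product_coordinates continuous_on_product_coordinates] .
  ultimately show ?thesis
    by (simp add: compact_Int_closed compact_sft_dual)
qed (simp add: sft_hat_def)

text \<open>The admissible pasts of \<open>x\<close> depend only on the symbol \<open>x\<^sub>0\<close>; this is the local product structure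
  that makes the best sums continuous.\<close>

lemma sft_hat_fibre_locally_constant:
  assumes "x \<in> sft r M" "x' \<in> sft r M" "x' 0 = x 0"
  shows "(y, x') \<in> sft_hat r M \<longleftrightarrow> (y, x) \<in> sft_hat r M"
  using assms by (simp add: sft_hat_def)

lemma continuous_on_best_sum:
  assumes "continuous_on (sft_hat r M) A"
  shows "continuous_on (sft r M) (best_sum r M A k)"
proof (induction k)
  case 0
  show ?case
    by (simp add: continuous_on_const cong: continuous_on_cong)
next
  case (Suc k)
  have "continuous_on (sft_hat r M) (\<lambda>p. A p + best_sum r M A k (tau p))"
    by (intro continuous_on_add assms continuous_on_compose_tau Suc.IH)
  then have "continuous_on (sft r M)
      (\<lambda>x. Sup ((\<lambda>p. A p + best_sum r M A k (tau p)) ` {p \<in> sft_hat r M. snd p = x}))"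
  proof (rule continuous_on_fibre_Sup)
    fix x assume x: "x \<in> sft r M"
    have "open ((\<lambda>x'. x' 0) -` {x 0})"
      by (intro open_vimage continuous_on_product_coordinates Topological_Spaces.open_discrete)
    then show "\<exists>U C. open U \<and> x \<in> U \<and> compact C \<and>
        (\<forall>x'\<in>sft r M \<inter> U. \<forall>y. (y, x') \<in> sft_hat r M \<longleftrightarrow> y \<in> C)"
      using sft_hat_fibre_locally_constant[OF x] compact_fibre[of x r M]
      by (intro exI[of _ "(\<lambda>x'. x' 0) -` {x 0}"] exI[of _ "{y. (y, x) \<in> sft_hat r M}"]) auto
  qed
  then show ?case
    by simp
qed

text \<open>The supremum in the recursion is attained because the fibre is compact; the last clause is the
  Bellman inequality.\<close>

lemma best_sum_fibre_maximum:
  assumes A: "continuous_on (sft_hat r M) A" and p: "p \<in> sft_hat r M"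
  obtains q where "q \<in> sft_hat r M" "snd q = snd p"
    "best_sum r M A (Suc k) (snd p) = A q + best_sum r M A k (tau q)"
    "A p + best_sum r M A k (tau p) \<le> best_sum r M A (Suc k) (snd p)"
proof -
  let ?C = "{y. (y, snd p) \<in> sft_hat r M}"
  let ?W = "\<lambda>q. A q + best_sum r M A k (tau q)"
  have W: "continuous_on (sft_hat r M) ?W"
    by (intro continuous_on_add A continuous_on_compose_tau continuous_on_best_sum)
  have "continuous_on ?C (\<lambda>y. ?W (y, snd p))"
    by (rule continuous_on_compose2[OF W continuous_on_Pair[OF continuous_on_id continuous_on_const]]) auto
  moreover have "fst p \<in> ?C"
    using p by simp
  ultimately obtain y where y: "y \<in> ?C" "\<And>y'. y' \<in> ?C \<Longrightarrow> ?W (y', snd p) \<le> ?W (y, snd p)"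
    using continuous_attains_sup[OF compact_fibre, of "snd p" r M "\<lambda>y. ?W (y, snd p)"] by blast
  have le: "?W q \<le> ?W (y, snd p)" if "q \<in> sft_hat r M" "snd q = snd p" for q
    using y(2)[of "fst q"] that by (metis mem_Collect_eq prod.collapse)
  then have "best_sum r M A (Suc k) (snd p) = ?W (y, snd p)"
    unfolding best_sum.simps using y(1) by (intro cSup_eq_maximum) auto
  then show thesis
    using that[of "(y, snd p)"] y(1) le[OF p] by simp
qed

lemma best_sum_attained_along_orbit:
  assumes A: "continuous_on (sft_hat r M) A" and "p \<in> sft_hat r M"
  shows "\<exists>z. (\<forall>i. z i \<in> sft_hat r M) \<and> snd (z 0) = snd p \<and>
    (\<forall>i<n. snd (z (Suc i)) = tau (z i)) \<and> (\<Sum>i<n. A (z i)) = best_sum r M A n (snd p)"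
  using assms(2)
proof (induction n arbitrary: p)
  case 0
  then show ?case
    by (intro exI[of _ "\<lambda>_. p"]) simp
next
  case (Suc n)
  obtain q where q: "q \<in> sft_hat r M" "snd q = snd p"
    "best_sum r M A (Suc n) (snd p) = A q + best_sum r M A n (tau q)"
    using best_sum_fibre_maximum[OF A Suc.prems, of n] by metis
  obtain q' where q': "q' \<in> sft_hat r M" "snd q' = tau q"
    using sft_hat_successor[OF q(1)] .
  obtain z where z: "\<And>i. z i \<in> sft_hat r M" "snd (z 0) = tau q"
    "\<And>i. i < n \<Longrightarrow> snd (z (Suc i)) = tau (z i)" "(\<Sum>i<n. A (z i)) = best_sum r M A n (tau q)"
    using Suc.IH[OF q'(1)] q'(2) by auto
  show ?case
  proof (intro exI[of _ "case_nat q z"] conjI allI impI)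
    show "case_nat q z i \<in> sft_hat r M" for i
      using q(1) z(1) by (cases i) auto
    show "snd (case_nat q z (Suc i)) = tau (case_nat q z i)" if "i < Suc n" for i
      using that z(2,3) by (cases i) auto
    show "(\<Sum>i<Suc n. A (case_nat q z i)) = best_sum r M A (Suc n) (snd p)"
      using q(3) z(4) by (simp add: sum.lessThan_Suc_shift del: sum.lessThan_Suc best_sum.simps)
  qed (use q(2) in simp)
qed

text \<open>An almost optimal test function. The Bellman inequality bounds
  \<open>A p + V\<^sub>k (\<tau> p) - V\<^sub>k (snd p)\<close> by \<open>V\<^sub>k\<^sub>+\<^sub>1 (snd p) - V\<^sub>k (snd p)\<close>, where \<open>V\<^sub>k\<close> is the best sum over \<open>k\<close>
  steps; in the average over \<open>k < n\<close> the bounds telescope to \<open>V\<^sub>n (snd p) / n\<close>.\<close>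

lemma averaged_best_sums_bound:
  assumes A: "continuous_on (sft_hat r M) A" and p: "p \<in> sft_hat r M" and "n > 0"
    and f_def: "f = (\<lambda>x. - (\<Sum>k<n. best_sum r M A k x) / real n)"
  shows "A p + f (snd p) - f (tau p) \<le> best_sum r M A n (snd p) / real n"
proof -
  let ?V = "best_sum r M A"
  have step: "A p + ?V k (tau p) \<le> ?V (Suc k) (snd p)" for k
    using best_sum_fibre_maximum[OF A p, of k] by metis
  have "real n * (A p + f (snd p) - f (tau p)) =
      real n * A p + (\<Sum>k<n. ?V k (tau p)) - (\<Sum>k<n. ?V k (snd p))"
    using \<open>n > 0\<close> by (simp add: f_def field_simps)
  also have "\<dots> = (\<Sum>k<n. A p + ?V k (tau p) - ?V k (snd p))"
    by (simp add: sum.distrib sum_subtractf)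
  also have "\<dots> \<le> (\<Sum>k<n. ?V (Suc k) (snd p) - ?V k (snd p))"
    using step by (intro sum_mono) (simp del: best_sum.simps)
  also have "\<dots> = ?V n (snd p) - ?V 0 (snd p)"
    by (rule sum_lessThan_telescope)
  finally show ?thesis
    using \<open>n > 0\<close> by (simp add: field_simps)
qed

section \<open>The duality\<close>

text \<open>\<^const>\<open>max_over\<close> is defined by a description operator; the next two facts recover its meaning
  wherever a maximum exists.\<close>

lemma max_over_attained:
  assumes "has_max g S"
  obtains p where "p \<in> S" "max_over g S = g p"
  using assms max_over_eq[of _ S g] unfolding has_max_def by metis

lemma max_over_upper: "has_max g S \<Longrightarrow> p \<in> S \<Longrightarrow> g p \<le> max_over g S"
  using max_over_eq[of _ S g] unfolding has_max_def by metis

lemma continuous_on_cocycle: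
  fixes A :: "(nat \<Rightarrow> nat) \<times> (nat \<Rightarrow> nat) \<Rightarrow> real"
  assumes "continuous_on (sft_hat r M) A" "continuous_on (sft r M) f"
  shows "continuous_on (sft_hat r M) (\<lambda>p. A p + f (snd p) - f (tau p))"
  by (intro continuous_on_diff continuous_on_add assms continuous_on_compose_tau
      continuous_on_compose_snd)

lemma has_max_cocycle:
  assumes "sft r M \<noteq> {}" "continuous_on (sft_hat r M) A" "continuous_on (sft r M) f"
  shows "has_max (\<lambda>p. A p + f (snd p) - f (tau p)) (sft_hat r M)"
  using continuous_attains_sup[OF compact_sft_hat sft_hat_nonempty[OF assms(1)]
      continuous_on_cocycle[OF assms(2,3)]]
  unfolding has_max_def by blast

lemma holonomic_eq:
  assumes "0 < l" "l < 1"
  shows "holonomic l r M = {\<mu>. prob_space \<mu> \<and> sets \<mu> = sets (borel_of_top (top_of_set (sft_hat r M))) \<and>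
    (\<forall>f :: (nat \<Rightarrow> nat) \<Rightarrow> real. continuous_on (sft r M) f \<longrightarrow> (\<integral>p. f (tau p) \<partial>\<mu>) = (\<integral>p. f (snd p) \<partial>\<mu>))}"
  by (simp add: holonomic_def C0_def sft_top_eq[OF assms] sft_hat_top_eq[OF assms])

text \<open>Weak duality: the holonomy condition says that adding \<open>f \<circ> snd - f \<circ> tau\<close> does not change
  the integral, and an integral against a probability is at most the maximum.\<close>

lemma holonomic_integral_le:
  assumes "0 < l" "l < 1" "sft r M \<noteq> {}" and \<mu>: "\<mu> \<in> holonomic l r M"
    and A: "continuous_on (sft_hat r M) A" and f: "continuous_on (sft r M) f"
  shows "(\<integral>p. A p \<partial>\<mu>) \<le> max_over (\<lambda>p. A p + f (snd p) - f (tau p)) (sft_hat r M)"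
proof -
  let ?g = "\<lambda>p. A p + f (snd p) - f (tau p)"
  have \<mu>': "prob_space \<mu>" "sets \<mu> = sets (borel_of_top (top_of_set (sft_hat r M)))"
    "(\<integral>p. f (tau p) \<partial>\<mu>) = (\<integral>p. f (snd p) \<partial>\<mu>)"
    using \<mu> f by (auto simp: holonomic_eq[OF assms(1,2)])
  interpret prob_space \<mu>
    by (rule \<mu>'(1))
  note integrable = integrable_continuous_on_compact[OF \<mu>'(1,2) compact_sft_hat]
  have "(\<integral>p. A p \<partial>\<mu>) = (\<integral>p. ?g p \<partial>\<mu>)"
    using \<mu>'(3) integrable[OF A] integrable[OF continuous_on_compose_snd[OF f]]
      integrable[OF continuous_on_compose_tau[OF f]] by simp
  also have "\<dots> \<le> (\<integral>p. max_over ?g (sft_hat r M) \<partial>\<mu>)"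
  proof (rule integral_mono)
    show "integrable \<mu> ?g"
      by (rule integrable[OF continuous_on_cocycle[OF A f]])
    fix p assume "p \<in> space \<mu>"
    then have "p \<in> sft_hat r M"
      using sets_eq_imp_space_eq[OF \<mu>'(2)] by (simp add: space_borel_of_top)
    then show "?g p \<le> max_over ?g (sft_hat r M)"
      by (rule max_over_upper[OF has_max_cocycle[OF assms(3) A f]])
  qed simp
  also have "\<dots> = max_over ?g (sft_hat r M)"
    by (simp add: prob_space)
  finally show ?thesis .
qed

text \<open>Strong duality: \<open>\<mu>\<close> is a weak limit of the empirical measures on orbits that realise the best
  sums. Along an orbit \<open>h (\<tau> p) - h (snd p)\<close> telescopes, so its average over \<open>n\<close> steps is at most \<open>2 B / n\<close> in
  absolute value for \<open>\<bar>h\<bar> \<le> B\<close>, and the limit is holonomic. The averages of \<open>A\<close> along these orbits dominate the maxima for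
  the test functions of \<open>averaged_best_sums_bound\<close> and hence every common lower bound \<open>b\<close> of the dual
  values.\<close>

lemma optimal_holonomic_measure:
  assumes "0 < l" "l < 1" "sft r M \<noteq> {}" and A: "continuous_on (sft_hat r M) A"
  obtains \<mu> where "\<mu> \<in> holonomic l r M"
    "\<And>b. \<forall>f. continuous_on (sft r M) f \<longrightarrow>
        b \<le> max_over (\<lambda>p. A p + f (snd p) - f (tau p)) (sft_hat r M) \<Longrightarrow> b \<le> (\<integral>p. A p \<partial>\<mu>)"
proof -
  let ?K = "sft_hat r M" and ?V = "best_sum r M A"
  let ?m = "\<lambda>f. max_over (\<lambda>p. A p + f (snd p) - f (tau p)) ?K"
  define f where "f n x = - (\<Sum>k<Suc n. ?V k x) / real (Suc n)" for n x
  have f: "continuous_on (sft r M) (f n)" for n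
    unfolding f_def by (intro continuous_intros continuous_on_best_sum A) simp
  let ?orbit = "\<lambda>n z. (\<forall>i. z i \<in> ?K) \<and> (\<forall>i<Suc n. snd (z (Suc i)) = tau (z i)) \<and>
    ?m (f n) \<le> (\<Sum>i<Suc n. A (z i)) / real (Suc n)"
  have "\<exists>z. ?orbit n z" for n
  proof -
    obtain p where p: "p \<in> ?K" "?m (f n) = A p + f n (snd p) - f n (tau p)"
      using max_over_attained[OF has_max_cocycle[OF assms(3) A f]] .
    have "?m (f n) \<le> ?V (Suc n) (snd p) / real (Suc n)"
      unfolding p(2) by (rule averaged_best_sums_bound[OF A p(1)]) (auto simp: f_def)
    moreover obtain z where "\<forall>i. z i \<in> ?K" "\<forall>i<Suc n. snd (z (Suc i)) = tau (z i)"
      "(\<Sum>i<Suc n. A (z i)) = ?V (Suc n) (snd p)"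
      using best_sum_attained_along_orbit[OF A p(1), of "Suc n"] by blast
    ultimately show ?thesis
      by (intro exI[of _ z]) (simp only: simp_thms)
  qed
  then have "\<forall>n. \<exists>z. ?orbit n z"
    by (rule allI)
  from choice[OF this] obtain z where "\<forall>n. ?orbit n (z n)"
    by (rule exE)
  then have z: "\<And>n i. z n i \<in> ?K"
    and orbit: "\<And>n i. i < Suc n \<Longrightarrow> snd (z n (Suc i)) = tau (z n i)"
    and average: "\<And>n. ?m (f n) \<le> (\<Sum>i<Suc n. A (z n i)) / real (Suc n)"
    by blast+
  obtain \<phi> :: "(nat \<Rightarrow> nat) \<times> (nat \<Rightarrow> nat) \<Rightarrow> real" where \<phi>: "continuous_on ?K \<phi>" "inj_on \<phi> ?K"
    using sft_hat_embeds_in_real .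
  obtain s \<mu> where s: "strict_mono s"
    and \<mu>: "prob_space \<mu>" "sets \<mu> = sets (borel_of_top (top_of_set ?K))"
    and limit: "\<And>g :: (nat \<Rightarrow> nat) \<times> (nat \<Rightarrow> nat) \<Rightarrow> real. continuous_on ?K g \<Longrightarrow>
      (\<lambda>n. (\<Sum>i<Suc (s n). g (z (s n) i)) / real (Suc (s n))) \<longlonglongrightarrow> (\<integral>p. g p \<partial>\<mu>)"
    by (rule empirical_averages_converge[where z = z, OF compact_sft_hat \<phi>]) (use z in blast)+
  have "(\<integral>p. h (tau p) \<partial>\<mu>) = (\<integral>p. h (snd p) \<partial>\<mu>)" if h: "continuous_on (sft r M) h" for h :: "(nat \<Rightarrow> nat) \<Rightarrow> real"
  proof -
    let ?g = "\<lambda>p. h (tau p) - h (snd p)"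
    obtain B where B: "\<And>x. x \<in> sft r M \<Longrightarrow> \<bar>h x\<bar> \<le> B"
      using compact_imp_bounded[OF compact_continuous_image[OF h compact_sft]]
      by (auto simp: bounded_iff)
    let ?avg = "\<lambda>n. (\<Sum>i<Suc n. ?g (z n i)) / real (Suc n)"
    have "norm (?avg n) \<le> 2 * B / real (Suc n)" for n
    proof -
      have "(\<Sum>i<Suc n. ?g (z n i)) = (\<Sum>i<Suc n. h (snd (z n (Suc i))) - h (snd (z n i)))"
        using orbit by (intro sum.cong) auto
      also have "\<dots> = h (snd (z n (Suc n))) - h (snd (z n 0))"
        by (rule sum_lessThan_telescope)
      finally have "\<bar>\<Sum>i<Suc n. ?g (z n i)\<bar> \<le> 2 * B"
        using B[OF snd_in_sft[OF z], of n "Suc n"] B[OF snd_in_sft[OF z], of n 0] by linarith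
      then show ?thesis
        by (simp add: divide_right_mono del: sum.lessThan_Suc)
    qed
    then have "\<forall>\<^sub>F n in sequentially. norm (?avg n) \<le> 2 * B / real (Suc n)"
      by (rule always_eventually[OF allI])
    then have "?avg \<longlonglongrightarrow> 0"
      by (rule Lim_null_comparison) (rule LIMSEQ_Suc[OF lim_const_over_n])
    from LIMSEQ_subseq_LIMSEQ[OF this s] have "(\<lambda>n. ?avg (s n)) \<longlonglongrightarrow> 0"
      by (simp only: o_def)
    moreover have g: "continuous_on ?K ?g"
      by (intro continuous_on_diff continuous_on_compose_tau continuous_on_compose_snd h)
    ultimately have "(\<integral>p. ?g p \<partial>\<mu>) = 0"
      using LIMSEQ_unique[OF limit[OF g]] by simp
    then show ?thesis
      using integrable_continuous_on_compact[OF \<mu> compact_sft_hat continuous_on_compose_tau[OF h]]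
        integrable_continuous_on_compact[OF \<mu> compact_sft_hat continuous_on_compose_snd[OF h]]
      by simp
  qed
  then have "\<mu> \<in> holonomic l r M"
    using \<mu> by (simp add: holonomic_eq[OF assms(1,2)])
  moreover have "b \<le> (\<integral>p. A p \<partial>\<mu>)" if b: "\<forall>f. continuous_on (sft r M) f \<longrightarrow> b \<le> ?m f" for b
  proof (rule LIMSEQ_le_const[OF limit[OF A]], intro exI allI impI)
    show "b \<le> (\<Sum>i<Suc (s n). A (z (s n) i)) / real (Suc (s n))" for n
      by (rule order_trans[OF b[rule_format, OF f] average])
  qed
  ultimately show thesis
    by (rule that)
qed

theorem theorem1:
  fixes r :: nat and M :: "nat \<Rightarrow> nat \<Rightarrow> nat" and l :: real
    and A :: "(nat \<Rightarrow> nat) \<times> (nat \<Rightarrow> nat) \<Rightarrow> real"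
  assumes "\<forall>i\<in>{1..r}. \<forall>j\<in>{1..r}. M i j \<in> {0, 1}"
    and "sft r M \<noteq> {}"
    and "0 < l" and "l < 1"
    and "A \<in> C0 (sft_hat_top l r M)"
  shows "has_max (\<lambda>\<mu>. \<integral>p. A p \<partial>\<mu>) (holonomic l r M) \<and>
    (\<forall>f\<in>C0 (sft_top l r M). has_max (\<lambda>p. A p + f (snd p) - f (tau p)) (sft_hat r M)) \<and>
    bdd_below ((\<lambda>f. max_over (\<lambda>p. A p + f (snd p) - f (tau p)) (sft_hat r M)) ` C0 (sft_top l r M)) \<and>
    beta l r M A =
      (INF f\<in>C0 (sft_top l r M). max_over (\<lambda>p. A p + f (snd p) - f (tau p)) (sft_hat r M))"
proof -
  let ?m = "\<lambda>f. max_over (\<lambda>p. A p + f (snd p) - f (tau p)) (sft_hat r M)"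
  have C0: "C0 (sft_top l r M) = {f. continuous_on (sft r M) f}"
    by (simp add: C0_def sft_top_eq[OF assms(3,4)])
  have A: "continuous_on (sft_hat r M) A"
    using assms(5) by (simp add: C0_def sft_hat_top_eq[OF assms(3,4)])
  have upper: "(\<integral>p. A p \<partial>\<nu>) \<le> ?m f"
    if "\<nu> \<in> holonomic l r M" "f \<in> C0 (sft_top l r M)" for \<nu> f
    using holonomic_integral_le[OF assms(3,4,2) that(1) A] that(2) by (simp add: C0)
  obtain \<mu> where \<mu>: "\<mu> \<in> holonomic l r M"
    and lower: "\<And>b. \<forall>f. continuous_on (sft r M) f \<longrightarrow> b \<le> ?m f \<Longrightarrow> b \<le> (\<integral>p. A p \<partial>\<mu>)"
    by (rule optimal_holonomic_measure[OF assms(3,4,2) A]) blast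
  have bdd: "bdd_below (?m ` C0 (sft_top l r M))"
    using upper[OF \<mu>] by (intro bdd_belowI2)
  have nonempty: "C0 (sft_top l r M) \<noteq> {}"
    using continuous_on_const by (auto simp: C0)
  have INF: "(INF f\<in>C0 (sft_top l r M). ?m f) = (\<integral>p. A p \<partial>\<mu>)"
  proof (rule antisym)
    show "(INF f\<in>C0 (sft_top l r M). ?m f) \<le> (\<integral>p. A p \<partial>\<mu>)"
      using cINF_lower[OF bdd] by (intro lower) (simp add: C0)
    show "(\<integral>p. A p \<partial>\<mu>) \<le> (INF f\<in>C0 (sft_top l r M). ?m f)"
      using upper[OF \<mu>] by (intro cINF_greatest nonempty)
  qed
  have maximal: "(\<integral>p. A p \<partial>\<nu>) \<le> (\<integral>p. A p \<partial>\<mu>)" if "\<nu> \<in> holonomic l r M" for \<nu>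
    unfolding INF[symmetric] using upper[OF that] by (intro cINF_greatest nonempty)
  have "beta l r M A = (\<integral>p. A p \<partial>\<mu>)"
    unfolding beta_def by (rule max_over_eq[where g = "\<lambda>\<nu>. \<integral>p. A p \<partial>\<nu>", OF \<mu> maximal])
  moreover have "has_max (\<lambda>\<mu>. \<integral>p. A p \<partial>\<mu>) (holonomic l r M)"
    unfolding has_max_def using \<mu> maximal by blast
  moreover have "has_max (\<lambda>p. A p + f (snd p) - f (tau p)) (sft_hat r M)"
    if "f \<in> C0 (sft_top l r M)" for f
    using has_max_cocycle[OF assms(2) A] that by (simp add: C0)
  ultimately show ?thesis
    using bdd INF by auto
qed

end
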